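(* Let $\{B_k\}\subseteq\mathbb R^{n\times n}$ be a sequence of positive definite symmetric matrices, and assume that there exist $0<\nu_1\le\nu_2$ such that $\nu_1\le\lambda_{\min}(B_k)\le\lambda_{\max}(B_k)\le\nu_2$ for all $k$. Let $\{\eta_k\}$ be a sequence such that $\eta_{\min}\le\eta_k\le\eta_{\max}$ for all $k$, where $0<\eta_{\min}\le\eta_{\max}<+\infty$ are fixed, and assume $\eta_{\max}<\frac{2}{\nu_1}$. Let $\{x_k\}\subseteq\mathcal S$ be the sequence of iterates and let, for each $k\ge 1$, $$\hat d_k=\mathcal P_{\mathcal S}[x_k-\eta_k\nabla f(x_k)]-x_k,\qquad \hat s_k=\mathcal P_{\mathcal S}[x_k+(x_k-x_{k-1})]-x_k,$$ and let $d_k=\alpha_k\hat d_k+\beta_k\hat s_k$ be the solution of $$\min_{d,\alpha,\beta}\ \nabla f(x_k)^Td+\tfrac12d^TB_kd\quad\text{s.t.}\quad d=\alpha\hat d_k+\beta\hat s_k,\quad \alpha+\beta\le1,\quad \alpha\ge0,\ \beta\ge0.$$ Then, for any $\eta\in[\eta_{\min},\eta_{\max}]$, the sequence of directions $\{d_k\}$ satisfies the direction assumption; that is, there exist constants $a,c_1,c_2>0$ such that, for all $k$: $x_k+\alpha d_k\in\mathcal S$ for all $\alpha\in[0,a]$; $\nabla f(x_k)^Td_k\le-c_1\|d_k\|^2$; and $\nabla f(x_k)^Td_k\le-c_2\|\mathcal P_{\mathcal S}[x_k-\eta\nabla f(x_k)]-x_k\|^2$.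
   Context: Setting: $\mathcal S\subset\mathbb R^n$ is a (nonempty) closed convex set; $f:\mathbb R^n\to\mathbb R$ is smooth, possibly nonconvex, bounded below over $\mathcal S$, and $\nabla f$ is Lipschitz continuous with constant $L$ on an open convex set $\mathcal D\supseteq\mathcal S$. $\mathcal P_{\mathcal S}[x]=\arg\min_{y\in\mathcal S}\|x-y\|$ is the Euclidean projection; norms are Euclidean. $\lambda_{\min},\lambda_{\max}$ denote the smallest and largest eigenvalues. *)

theory Defs
  imports "HOL-Analysis.Analysis"
begin

definition symmetric_mat :: "real ^ 'n ^ 'n \<Rightarrow> bool"
  where "symmetric_mat A \<longleftrightarrow> transpose A = A"

definition pos_definite :: "real ^ 'n ^ 'n \<Rightarrow> bool"
  where "pos_definite A \<longleftrightarrow> (\<forall>v. v \<noteq> 0 \<longrightarrow> v \<bullet> (A *v v) > 0)"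

definition eigenvalues :: "real ^ 'n ^ 'n \<Rightarrow> real set"
  where "eigenvalues A = {l. \<exists>v. v \<noteq> 0 \<and> A *v v = l *\<^sub>R v}"

(* Real eigenvalues only: for a symmetric matrix the set is finite and nonempty,
   so that Min and Max are meaningful. *)

definition lambda_min :: "real ^ 'n ^ 'n \<Rightarrow> real"
  where "lambda_min A = Min (eigenvalues A)"

definition lambda_max :: "real ^ 'n ^ 'n \<Rightarrow> real"
  where "lambda_max A = Max (eigenvalues A)"

(* The variables of the subproblem are the triples (d, \<alpha>, \<beta>). *)

definition subproblem_objective ::
    "real ^ 'n \<Rightarrow> real ^ 'n ^ 'n \<Rightarrow> (real ^ 'n) \<times> real \<times> real \<Rightarrow> real"
  where "subproblem_objective g B = (\<lambda>(d, \<alpha>, \<beta>). g \<bullet> d + 1 / 2 * (d \<bullet> (B *v d)))"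

definition subproblem_feasible ::
    "real ^ 'n \<Rightarrow> real ^ 'n \<Rightarrow> (real ^ 'n) \<times> real \<times> real \<Rightarrow> bool"
  where "subproblem_feasible dhat shat = (\<lambda>(d, \<alpha>, \<beta>).
    d = \<alpha> *\<^sub>R dhat + \<beta> *\<^sub>R shat \<and> \<alpha> + \<beta> \<le> 1 \<and> \<alpha> \<ge> 0 \<and> \<beta> \<ge> 0)"

(* The argument G is the gradient map of the objective function.  Directions are defined
   from index 1 on, since d 1 already involves the iterate x 0. *)

definition direction_assumption ::
    "(real ^ 'n) set \<Rightarrow> (real ^ 'n \<Rightarrow> real ^ 'n) \<Rightarrow> real
      \<Rightarrow> (nat \<Rightarrow> real ^ 'n) \<Rightarrow> (nat \<Rightarrow> real ^ 'n) \<Rightarrow> bool"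
  where "direction_assumption S G \<eta> x d \<longleftrightarrow>
    (\<exists>a c1 c2. a > 0 \<and> c1 > 0 \<and> c2 > 0 \<and>
      (\<forall>k\<ge>1.
        (\<forall>t\<in>{0..a}. x k + t *\<^sub>R d k \<in> S) \<and>
        G (x k) \<bullet> d k \<le> - c1 * (norm (d k))\<^sup>2 \<and>
        G (x k) \<bullet> d k \<le> - c2 * (norm (closest_point S (x k - \<eta> *\<^sub>R G (x k)) - x k))\<^sup>2))"

end

(* Comparing the minimizer d with the feasible point 0 gives
   g . d <= - (1/2) d . B d, hence the second inequality, while comparing it with a fixed
   multiple of the projected gradient step bounds g . d by minus a multiple of the squared
   length of that step.  Projected gradient steps with two different step sizes have comparable
   lengths, which replaces the step size of iteration k by an arbitrary one. *)
theory Submission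
  imports Defs
begin

section \<open>Rayleigh bounds for symmetric matrices\<close>

lemma symmetric_mat_inner:
  assumes "symmetric_mat A"
  shows "u \<bullet> (A *v v) = (A *v u) \<bullet> v"
  by (metis assms dot_lmul_matrix symmetric_mat_def transpose_matrix_vector)

text \<open>Eigenvectors for distinct eigenvalues of a symmetric matrix are orthogonal, so choosing
  one per eigenvalue gives an independent, hence finite, family. Finiteness is what gives
  \<open>Min\<close> and \<open>Max\<close> in \<open>lambda_min\<close> and
  \<open>lambda_max\<close> their usual properties.\<close>

lemma finite_eigenvalues:
  fixes A :: "real ^ 'n ^ 'n"
  assumes "symmetric_mat A"
  shows "finite (eigenvalues A)"
proof -
  have "\<forall>l\<in>eigenvalues A. \<exists>v. v \<noteq> 0 \<and> A *v v = l *\<^sub>R v"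
    by (simp add: eigenvalues_def)
  from bchoice[OF this] obtain e
    where e: "\<And>l. l \<in> eigenvalues A \<Longrightarrow> e l \<noteq> 0 \<and> A *v e l = l *\<^sub>R e l"
    by blast
  have orth: "e l \<bullet> e m = 0" if "l \<in> eigenvalues A" "m \<in> eigenvalues A" "l \<noteq> m" for l m
    using symmetric_mat_inner[OF assms, of "e l" "e m"] e[OF that(1)] e[OF that(2)] that(3)
    by simp
  have inj: "inj_on e (eigenvalues A)"
    using orth e by (metis inj_onI inner_eq_zero_iff)
  have "pairwise orthogonal (e ` eigenvalues A)"
    using orth by (auto simp: pairwise_def orthogonal_def)
  moreover have "0 \<notin> e ` eigenvalues A"
    using e by (metis imageE)
  ultimately have "finite (e ` eigenvalues A)"
    using independent_imp_finite pairwise_orthogonal_independent by blast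
  then show ?thesis
    using inj finite_image_iff by blast
qed

text \<open>If \<open>C *v u\<close> were nonzero, a short move from \<open>u\<close> against it
  would lower the form to first order, below its least value 0.\<close>

lemma nonneg_form_kernel:
  fixes C :: "real ^ 'n ^ 'n"
  assumes sym: "symmetric_mat C" and nonneg: "\<And>v. 0 \<le> v \<bullet> (C *v v)"
    and zero: "u \<bullet> (C *v u) = 0"
  shows "C *v u = 0"
proof (rule ccontr)
  define w where "w = C *v u"
  define K where "K = w \<bullet> (C *v w)"
  assume "C *v u \<noteq> 0"
  then have w: "0 < w \<bullet> w" by (simp add: w_def)
  have K: "0 \<le> K" using nonneg by (simp add: K_def)
  have exp: "(u - t *\<^sub>R w) \<bullet> (C *v (u - t *\<^sub>R w)) = t * (t * K - 2 * (w \<bullet> w))" for t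
    using zero symmetric_mat_inner[OF sym, of u w]
    by (simp add: matrix_vector_mult_diff_distrib matrix_vector_mult_scaleR
        inner_diff_left inner_diff_right K_def w_def[symmetric] inner_commute algebra_simps)
  \<comment> \<open>Small enough that the quadratic term \<open>t * K\<close> cannot offset
    \<open>2 * (w \<bullet> w)\<close>; the added 1 covers \<open>K = 0\<close>.\<close>
  define t where "t = (w \<bullet> w) / (1 + K)"
  have t: "0 < t" using w K by (simp add: t_def)
  have "t * K \<le> w \<bullet> w"
    using w K by (simp add: t_def field_simps)
  then have "t * K - 2 * (w \<bullet> w) < 0" using w by linarith
  then have "t * (t * K - 2 * (w \<bullet> w)) < 0" using t by (rule mult_pos_neg[rotated])
  then show False using exp nonneg by (metis not_le)
qed

text \<open>The sign of \<open>s\<close> selects a minimizer or a maximizer on the unit sphere, so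
  one proof serves both ends of the spectrum. With \<open>m\<close> the extreme value, the form of
  \<open>s *\<^sub>R (A - m *\<^sub>R mat 1)\<close> is nonnegative and vanishes at
  \<open>u\<close>, which puts \<open>u\<close> in its kernel.\<close>

lemma rayleigh_extremum_eigenvalue:
  fixes A :: "real ^ 'n ^ 'n" and s :: real
  assumes sym: "symmetric_mat A" and u: "norm u = 1" and s: "s \<noteq> 0"
    and ext: "\<And>v. norm v = 1 \<Longrightarrow> s * (u \<bullet> (A *v u)) \<le> s * (v \<bullet> (A *v v))"
  shows "u \<bullet> (A *v u) \<in> eigenvalues A"
    and "s * (u \<bullet> (A *v u)) * (norm v)\<^sup>2 \<le> s * (v \<bullet> (A *v v))"
proof -
  define m where "m = u \<bullet> (A *v u)"
  define C where "C = s *\<^sub>R (A - m *\<^sub>R mat 1)"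
  have Cv: "C *v v = s *\<^sub>R (A *v v - m *\<^sub>R v)" for v
    by (simp add: C_def scaleR_matrix_vector_assoc[symmetric] matrix_vector_mult_diff_rdistrib)
  have symC: "symmetric_mat C"
    using sym by (simp add: C_def symmetric_mat_def transpose_def vec_eq_iff mat_def)
  have hom: "s * m * (norm v)\<^sup>2 \<le> s * (v \<bullet> (A *v v))" for v
  proof (cases "v = 0")
    case False
    define w where "w = v /\<^sub>R norm v"
    have v: "v = norm v *\<^sub>R w" and w: "norm w = 1" using False by (auto simp: w_def)
    have "v \<bullet> (A *v v) = (norm v)\<^sup>2 * (w \<bullet> (A *v w))"
      by (subst (1 2) v) (simp add: matrix_vector_mult_scaleR power2_eq_square)
    moreover have "s * m * (norm v)\<^sup>2 \<le> s * (w \<bullet> (A *v w)) * (norm v)\<^sup>2"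
      using ext[OF w] by (intro mult_right_mono) (auto simp: m_def)
    ultimately show ?thesis by (simp add: mult_ac)
  qed simp
  then show "s * (u \<bullet> (A *v u)) * (norm v)\<^sup>2 \<le> s * (v \<bullet> (A *v v))"
    by (simp add: m_def)
  have "0 \<le> v \<bullet> (C *v v)" for v
    using hom[of v] by (simp add: Cv inner_diff_right power2_norm_eq_inner algebra_simps)
  moreover have "u \<bullet> (C *v u) = 0"
    using u by (simp add: Cv inner_diff_right m_def norm_eq_1)
  ultimately have "C *v u = 0" by (rule nonneg_form_kernel[OF symC])
  then have "A *v u = m *\<^sub>R u" using s by (simp add: Cv)
  moreover have "u \<noteq> 0" using u by auto
  ultimately show "u \<bullet> (A *v u) \<in> eigenvalues A"
    unfolding eigenvalues_def m_def by blast
qed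

text \<open>By compactness the form attains both extremes on the unit sphere. These are eigenvalues,
  so they lie between \<open>lambda_min A\<close> and \<open>lambda_max A\<close>.\<close>

lemma rayleigh_bounds:
  fixes A :: "real ^ 'n ^ 'n"
  assumes sym: "symmetric_mat A"
  shows "lambda_min A * (norm v)\<^sup>2 \<le> v \<bullet> (A *v v)"
    and "v \<bullet> (A *v v) \<le> lambda_max A * (norm v)\<^sup>2"
proof -
  let ?q = "\<lambda>v. v \<bullet> (A *v v)"
  let ?S = "sphere (0 :: real ^ 'n) 1"
  have S: "compact ?S" "?S \<noteq> {}" by auto
  have cont: "continuous_on ?S ?q"
    by (intro continuous_intros linear_continuous_on
        linear_conv_bounded_linear[THEN iffD1] matrix_vector_mul_linear)
  obtain a where a: "a \<in> ?S" "\<And>y. y \<in> ?S \<Longrightarrow> ?q a \<le> ?q y"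
    using continuous_attains_inf[OF S cont] by blast
  obtain b where b: "b \<in> ?S" "\<And>y. y \<in> ?S \<Longrightarrow> ?q y \<le> ?q b"
    using continuous_attains_sup[OF S cont] by blast
  \<comment> \<open>The factors 1 and -1 are the two instances of \<open>s\<close>.\<close>
  have a': "norm a = 1" "\<And>w. norm w = 1 \<Longrightarrow> 1 * ?q a \<le> 1 * ?q w"
    and b': "norm b = 1" "\<And>w. norm w = 1 \<Longrightarrow> - 1 * ?q b \<le> - 1 * ?q w"
    using a b by auto
  note min = rayleigh_extremum_eigenvalue[OF sym a'(1) one_neq_zero a'(2)]
  have "(- 1 :: real) \<noteq> 0" by simp
  note max = rayleigh_extremum_eigenvalue[OF sym b'(1) this b'(2)]
  have "lambda_min A \<le> ?q a"
    unfolding lambda_min_def using min(1) finite_eigenvalues[OF sym] by simp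
  then have "lambda_min A * (norm v)\<^sup>2 \<le> ?q a * (norm v)\<^sup>2"
    by (intro mult_right_mono) auto
  then show "lambda_min A * (norm v)\<^sup>2 \<le> ?q v"
    using min(2)[of v] by simp
  have "?q b \<le> lambda_max A"
    unfolding lambda_max_def using max(1) finite_eigenvalues[OF sym] by simp
  then have "?q b * (norm v)\<^sup>2 \<le> lambda_max A * (norm v)\<^sup>2"
    by (intro mult_right_mono) auto
  then show "?q v \<le> lambda_max A * (norm v)\<^sup>2"
    using max(2)[of v] by simp
qed

section \<open>Projected gradient steps\<close>

text \<open>This is the variational inequality of the projection, tested at the point
  \<open>x\<close> of \<open>S\<close>.\<close>

lemma projected_step_inner_le:
  fixes x g :: "'a::euclidean_space"
  assumes "convex S" "closed S" "x \<in> S" "0 < \<eta>"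
  defines "p \<equiv> closest_point S (x - \<eta> *\<^sub>R g) - x"
  shows "g \<bullet> p \<le> - ((norm p)\<^sup>2 / \<eta>)"
proof -
  have "(x - \<eta> *\<^sub>R g - (x + p)) \<bullet> (x - (x + p)) \<le> 0"
    using closest_point_dot[OF assms(1-3), of "x - \<eta> *\<^sub>R g"] by (simp add: p_def)
  then have "\<eta> * (g \<bullet> p) \<le> - (norm p)\<^sup>2"
    by (simp add: inner_diff_left power2_norm_eq_inner)
  then show ?thesis
    using assms(4) by (simp add: field_simps)
qed

text \<open>The variational inequality of each projection is tested at the other projected point.
  The factor \<open>c\<close> dominates both 1 and \<eta> / \<theta>, so neither step size needs to
  be the larger one.\<close>

lemma projected_step_norm_le:
  fixes x g :: "'a::euclidean_space"
  assumes "convex S" "closed S" "x \<in> S" "0 < \<eta>" "0 < \<theta>"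
    and c: "1 \<le> c" "\<eta> \<le> c * \<theta>"
  shows "norm (closest_point S (x - \<eta> *\<^sub>R g) - x)
    \<le> c * norm (closest_point S (x - \<theta> *\<^sub>R g) - x)"
proof -
  define p q where "p = closest_point S (x - \<eta> *\<^sub>R g) - x"
    and "q = closest_point S (x - \<theta> *\<^sub>R g) - x"
  have S: "x + p \<in> S" "x + q \<in> S"
    using assms closest_point_in_set[of S] by (auto simp: p_def q_def)
  have "(- (\<eta> *\<^sub>R g) - p) \<bullet> (q - p) \<le> 0" "(- (\<theta> *\<^sub>R g) - q) \<bullet> (p - q) \<le> 0"
    using closest_point_dot[OF assms(1,2) S(2), of "x - \<eta> *\<^sub>R g"]
      closest_point_dot[OF assms(1,2) S(1), of "x - \<theta> *\<^sub>R g"]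
    by (simp_all add: p_def q_def algebra_simps)
  \<comment> \<open>The weights \<theta> and \<eta> are chosen so that the terms with
    \<open>g\<close> cancel.\<close>
  then have "\<theta> * ((- (\<eta> *\<^sub>R g) - p) \<bullet> (q - p)) + \<eta> * ((- (\<theta> *\<^sub>R g) - q) \<bullet> (p - q)) \<le> 0"
    using assms(4,5) by (intro add_nonpos_nonpos mult_nonneg_nonpos) auto
  then have "\<theta> * (norm p)\<^sup>2 + \<eta> * (norm q)\<^sup>2 \<le> (\<theta> + \<eta>) * (p \<bullet> q)"
    by (simp add: power2_norm_eq_inner inner_diff_left inner_diff_right inner_commute algebra_simps)
  also have "\<dots> \<le> (\<theta> + \<eta>) * (norm p * norm q)"
    using assms(4,5) norm_cauchy_schwarz by (intro mult_left_mono) auto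
  \<comment> \<open>Thus \<open>norm p\<close> lies between \<open>norm q\<close> and \<eta> /
    \<theta> times \<open>norm q\<close>; exceeding \<open>c * norm q\<close> would make both
    factors positive.\<close>
  finally have key: "(\<theta> * norm p - \<eta> * norm q) * (norm p - norm q) \<le> 0"
    by (simp add: power2_eq_square algebra_simps)
  have "norm p \<le> c * norm q"
  proof (rule ccontr)
    assume "\<not> norm p \<le> c * norm q"
    then have less: "c * norm q < norm p" by simp
    have "norm q \<le> c * norm q" using c(1) by (simp add: mult_le_cancel_right1)
    moreover have "\<eta> * norm q \<le> \<theta> * (c * norm q)"
      using mult_right_mono[OF c(2) norm_ge_zero[of q]] by (simp add: mult_ac)
    moreover have "\<theta> * (c * norm q) < \<theta> * norm p" using less assms(5) by simp
    ultimately show False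
      using key less mult_pos_pos[of "\<theta> * norm p - \<eta> * norm q" "norm p - norm q"] by linarith
  qed
  then show ?thesis by (simp add: p_def q_def)
qed

section \<open>The two-dimensional subproblem\<close>

text \<open>The competitor uses only the projected gradient step, scaled by \<open>t\<close>. The
  parameter stays free because 0 and a tuned positive value are both used later.\<close>

lemma subproblem_argmin_le:
  assumes "is_arg_min (subproblem_objective g B) (subproblem_feasible p s) (d, \<alpha>, \<beta>)"
    and "0 \<le> t" "t \<le> 1"
  shows "g \<bullet> d + 1 / 2 * (d \<bullet> (B *v d)) \<le> t * (g \<bullet> p) + t\<^sup>2 / 2 * (p \<bullet> (B *v p))"
proof -
  have "subproblem_feasible p s (t *\<^sub>R p, t, 0)"
    using assms(2,3) by (simp add: subproblem_feasible_def)
  then have "subproblem_objective g B (d, \<alpha>, \<beta>) \<le> subproblem_objective g B (t *\<^sub>R p, t, 0)"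
    using assms(1) unfolding is_arg_min_def by (meson not_le)
  then show ?thesis
    by (simp add: subproblem_objective_def matrix_vector_mult_scaleR power2_eq_square)
qed

text \<open>The constraints on \<alpha> and \<beta> make the point a convex combination of
  \<open>x\<close>, \<open>x + p\<close> and \<open>x + s\<close>.\<close>

lemma feasible_step_in_set:
  assumes "convex S" "x \<in> S" "x + p \<in> S" "x + s \<in> S"
    and "subproblem_feasible p s (d, \<alpha>, \<beta>)" and "0 \<le> t" "t \<le> 1"
  shows "x + t *\<^sub>R d \<in> S"
proof -
  have d: "d = \<alpha> *\<^sub>R p + \<beta> *\<^sub>R s" and ab: "\<alpha> + \<beta> \<le> 1" "0 \<le> \<alpha>" "0 \<le> \<beta>"
    using assms(5) by (auto simp: subproblem_feasible_def)
  have "t * (\<alpha> + \<beta>) \<le> 1" using ab assms(6,7) by (intro mult_le_one) auto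
  then have "x + t *\<^sub>R d \<in> convex hull {x, x + p, x + s}"
    using ab assms(6) unfolding convex_hull_3 mem_Collect_eq
    by (intro exI[of _ "1 - t * (\<alpha> + \<beta>)"] exI[of _ "t * \<alpha>"] exI[of _ "t * \<beta>"])
      (auto simp: d algebra_simps)
  moreover have "convex hull {x, x + p, x + s} \<subseteq> S"
    using assms(1-4) by (intro hull_minimal) auto
  ultimately show ?thesis by blast
qed

text \<open>The upper bound \<open>h\<close> replaces the step size \<theta> in the constants, which
  makes them uniform over the iterations.\<close>

lemma subproblem_direction_bounds:
  assumes S: "convex S" "closed S" "x \<in> S"
    and B: "symmetric_mat B" "\<nu>1 \<le> lambda_min B" "lambda_max B \<le> \<nu>2" "0 < \<nu>1" "0 < \<nu>2"
    and \<theta>: "0 < \<theta>" "\<theta> \<le> h"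
    and p: "p = closest_point S (x - \<theta> *\<^sub>R g) - x"
    and min: "is_arg_min (subproblem_objective g B) (subproblem_feasible p s) (d, \<alpha>, \<beta>)"
  shows "g \<bullet> d \<le> - (\<nu>1 / 2) * (norm d)\<^sup>2"
    and "g \<bullet> d \<le> - (1 / (2 * h * (1 + h * \<nu>2))) * (norm p)\<^sup>2"
proof -
  have low: "\<nu>1 * (norm v)\<^sup>2 \<le> v \<bullet> (B *v v)" for v
    using rayleigh_bounds(1)[OF B(1), of v] mult_right_mono[OF B(2), of "(norm v)\<^sup>2"] by simp
  have up: "v \<bullet> (B *v v) \<le> \<nu>2 * (norm v)\<^sup>2" for v
    using rayleigh_bounds(2)[OF B(1), of v] mult_right_mono[OF B(3), of "(norm v)\<^sup>2"] by simp
  show "g \<bullet> d \<le> - (\<nu>1 / 2) * (norm d)\<^sup>2"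
    using subproblem_argmin_le[OF min, of 0] low[of d] by simp
  have h: "0 < h" using \<theta> by simp
  \<comment> \<open>With \<open>t * (h * \<nu>2) \<le> 1\<close> the quadratic term consumes at most
    half of the linear decrease \<open>t * N / h\<close>, and \<open>t \<le> 1\<close> keeps the
    competitor feasible.\<close>
  define t where "t = 1 / (1 + h * \<nu>2)"
  define N where "N = (norm p)\<^sup>2"
  have pos: "0 < 1 + h * \<nu>2" using h B(5) by (simp add: add_pos_pos)
  have t: "0 < t" "t \<le> 1" "t * (h * \<nu>2) \<le> 1"
    using h B(5) pos by (auto simp: t_def field_simps)
  have N: "0 \<le> N" by (simp add: N_def)
  have "0 \<le> d \<bullet> (B *v d)"
    using order_trans[OF mult_nonneg_nonneg low[of d]] B(4) by simp
  then have "g \<bullet> d \<le> t * (g \<bullet> p) + t\<^sup>2 / 2 * (p \<bullet> (B *v p))"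
    using subproblem_argmin_le[OF min, of t] t by simp
  also have "\<dots> \<le> t * (- (N / h)) + t\<^sup>2 / 2 * (\<nu>2 * N)"
  proof (intro add_mono mult_left_mono)
    have "g \<bullet> p \<le> - (N / \<theta>)"
      using projected_step_inner_le[OF S \<theta>(1), of g] by (simp add: p N_def)
    also have "\<dots> \<le> - (N / h)" using N \<theta> by (simp add: frac_le)
    finally show "g \<bullet> p \<le> - (N / h)" .
  qed (use t up[of p] in \<open>auto simp: N_def\<close>)
  also have "\<dots> = - (t * N / (2 * h)) * (2 - t * (h * \<nu>2))"
    using h by (simp add: field_simps power2_eq_square)
  also have "\<dots> \<le> - (t * N / (2 * h)) * 1"
    using t N h by (intro mult_left_mono_neg) auto
  also have "\<dots> = - (1 / (2 * h * (1 + h * \<nu>2))) * N"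
    by (simp add: t_def)
  finally show "g \<bullet> d \<le> - (1 / (2 * h * (1 + h * \<nu>2))) * (norm p)\<^sup>2"
    by (simp add: N_def)
qed

theorem proposition4p2:
  fixes S D :: "(real ^ 'n) set"
    and f :: "real ^ 'n \<Rightarrow> real" and gradf :: "real ^ 'n \<Rightarrow> real ^ 'n"
    and L \<nu>1 \<nu>2 \<eta>min \<eta>max :: real
    and B :: "nat \<Rightarrow> real ^ 'n ^ 'n"
    and \<eta>s \<alpha> \<beta> :: "nat \<Rightarrow> real"
    and x dhat shat d :: "nat \<Rightarrow> real ^ 'n"
  assumes "S \<noteq> {}" and "closed S" and "convex S"
    and "\<forall>y. GDERIV f y :> gradf y" and "continuous_on UNIV gradf"
    and "bdd_below (f ` S)"
    and "open D" and "convex D" and "S \<subseteq> D" and "L-lipschitz_on D gradf"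
    and "\<forall>k\<ge>1. symmetric_mat (B k) \<and> pos_definite (B k)"
    and "0 < \<nu>1" and "\<nu>1 \<le> \<nu>2"
    and "\<forall>k\<ge>1. \<nu>1 \<le> lambda_min (B k) \<and> lambda_min (B k) \<le> lambda_max (B k)
                 \<and> lambda_max (B k) \<le> \<nu>2"
    and "0 < \<eta>min" and "\<eta>min \<le> \<eta>max"
    and "\<forall>k\<ge>1. \<eta>min \<le> \<eta>s k \<and> \<eta>s k \<le> \<eta>max"
    and "\<eta>max < 2 / \<nu>1"
    and "\<forall>k. x k \<in> S"
    and "\<forall>k\<ge>1. dhat k = closest_point S (x k - \<eta>s k *\<^sub>R gradf (x k)) - x k"
    and "\<forall>k\<ge>1. shat k = closest_point S (x k + (x k - x (k - 1))) - x k"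
    and "\<forall>k\<ge>1. is_arg_min (subproblem_objective (gradf (x k)) (B k))
                   (subproblem_feasible (dhat k) (shat k)) (d k, \<alpha> k, \<beta> k)"
  shows "\<forall>\<eta>\<in>{\<eta>min..\<eta>max}. direction_assumption S gradf \<eta> x d"
proof
  fix \<eta> assume \<eta>: "\<eta> \<in> {\<eta>min..\<eta>max}"
  \<comment> \<open>\<open>r\<close> bounds the ratio of any two admissible step sizes, and
    \<open>c\<close> is the decrease constant for \<open>h = \<eta>max\<close>.\<close>
  define r where "r = \<eta>max / \<eta>min"
  define c where "c = 1 / (2 * \<eta>max * (1 + \<eta>max * \<nu>2))"
  have \<nu>2: "0 < \<nu>2" and \<eta>max: "0 < \<eta>max" and \<eta>0: "0 < \<eta>" and r: "1 \<le> r"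
    using assms(12,13,15,16) \<eta> by (auto simp: r_def)
  have c: "0 < c" using \<nu>2 \<eta>max by (simp add: c_def add_pos_pos)
  \<comment> \<open>The witnesses are \<open>a = 1\<close>, \<open>c1 = \<nu>1 / 2\<close> and
    \<open>c2 = c / r\<^sup>2\<close>, all independent of \<open>k\<close>; the square of
    \<open>r\<close> comes from comparing squared norms.\<close>
  have "(\<forall>t\<in>{0..1}. x k + t *\<^sub>R d k \<in> S) \<and>
      gradf (x k) \<bullet> d k \<le> - (\<nu>1 / 2) * (norm (d k))\<^sup>2 \<and>
      gradf (x k) \<bullet> d k \<le>
        - (c / r\<^sup>2) * (norm (closest_point S (x k - \<eta> *\<^sub>R gradf (x k)) - x k))\<^sup>2"
    if k: "1 \<le> k" for k
  proof (intro conjI ballI)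
    let ?p = "closest_point S (x k - \<eta> *\<^sub>R gradf (x k)) - x k"
    have xk: "x k \<in> S" using assms(19) by blast
    have \<theta>: "\<eta>min \<le> \<eta>s k" "\<eta>s k \<le> \<eta>max" "0 < \<eta>s k"
      using assms(15,17) k by force+
    have dh: "dhat k = closest_point S (x k - \<eta>s k *\<^sub>R gradf (x k)) - x k"
      and sh: "shat k = closest_point S (x k + (x k - x (k - 1))) - x k"
      and min: "is_arg_min (subproblem_objective (gradf (x k)) (B k))
                   (subproblem_feasible (dhat k) (shat k)) (d k, \<alpha> k, \<beta> k)"
      using assms(20-22) k by blast+
    have B: "symmetric_mat (B k)" "\<nu>1 \<le> lambda_min (B k)" "lambda_max (B k) \<le> \<nu>2"
      using assms(11,14) k by blast+
    note bounds = subproblem_direction_bounds[OF assms(3,2) xk B assms(12) \<nu>2 \<theta>(3,2) dh min]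
    show "gradf (x k) \<bullet> d k \<le> - (\<nu>1 / 2) * (norm (d k))\<^sup>2" by (rule bounds(1))
    show "x k + t *\<^sub>R d k \<in> S" if "t \<in> {0..1}" for t
    proof (rule feasible_step_in_set[OF assms(3) xk])
      show "x k + dhat k \<in> S" "x k + shat k \<in> S"
        using closest_point_in_set[OF assms(2,1)] by (simp_all add: dh sh)
      show "subproblem_feasible (dhat k) (shat k) (d k, \<alpha> k, \<beta> k)"
        using min by (simp add: is_arg_min_def)
    qed (use that in auto)
    \<comment> \<open>This supplies the ratio condition for passing from step size
      \<open>\<eta>s k\<close> to \<eta>.\<close>
    have "\<eta> \<le> r * \<eta>min" using \<eta> assms(15) by (simp add: r_def)
    also have "\<dots> \<le> r * \<eta>s k" using \<theta>(1) r by (intro mult_left_mono) auto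
    finally have "norm ?p \<le> r * norm (dhat k)"
      unfolding dh by (rule projected_step_norm_le[OF assms(3,2) xk \<eta>0 \<theta>(3) r])
    then have "(norm ?p)\<^sup>2 \<le> r\<^sup>2 * (norm (dhat k))\<^sup>2"
      using power_mono[of "norm ?p" "r * norm (dhat k)" 2] by (simp add: power_mult_distrib)
    then have "c / r\<^sup>2 * (norm ?p)\<^sup>2 \<le> c / r\<^sup>2 * (r\<^sup>2 * (norm (dhat k))\<^sup>2)"
      using c by (intro mult_left_mono) auto
    also have "\<dots> = c * (norm (dhat k))\<^sup>2" using r by simp
    finally show "gradf (x k) \<bullet> d k \<le> - (c / r\<^sup>2) * (norm ?p)\<^sup>2"
      using bounds(2) by (simp add: c_def)
  qed
  moreover have "0 < \<nu>1 / 2" "0 < c / r\<^sup>2" using assms(12) c r by auto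
  ultimately show "direction_assumption S gradf \<eta> x d"
    unfolding direction_assumption_def using zero_less_one by blast
qed

end
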